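(* Let $A=[a,b]$, let $\mathcal{I}$ be the collection of closed subintervals of $[a,b]$, let $\mathcal{D}$ be the class of all partitions of $[a,b]$ into closed subintervals, and let $\delta(D)$ be the norm of $D\in\mathcal{D}$. Let $\phi:\mathcal{I}\to\mathbb{R}^M$ be a quasi additive interval function with $\mathrm{BC}\int_A\|\phi\|<+\infty$, let $X\subset\mathbb{R}^N$ be compact, let $\zeta:\mathcal{I}\to\mathbb{R}^N$ be an interval function with $\zeta(I)\in X$ for all $I\in\mathcal{I}$, and let $F:X\times\mathbb{R}^M\to\mathbb{R}$ be a parametric integrand. Assume that for every $\varepsilon>0$ there exists $t(\varepsilon)>0$ such that for every $D_0=[I_0]\in\mathcal{D}$ with $\delta(D_0)<t(\varepsilon)$ there exists $T(\varepsilon,D_0)>0$ such that for every $D=[I]\in\mathcal{D}$ with $\delta(D)<T(\varepsilon,D_0)$, $$\max_{I_0\in D_0}\ \max_{I\in D,\ I\subset I_0}\ \|\zeta(I)-\zeta(I_0)\|<\varepsilon .$$ Then the interval function $\Phi:\mathcal{I}\to\mathbb{R}$ defined by $\Phi(I)=F(\zeta(I),\phi(I))$ is quasi additive.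
   Context: Closed subintervals are nondegenerate $[c,d]$, $c<d$. $D=[I]$ denotes the finite collection $\{[x_{i-1},x_i]\}_{i=1}^n$ associated with $a=x_0<\dots<x_n=b$, and $\delta(D)=\max_i(x_i-x_{i-1})$. $\|\cdot\|$ is the Euclidean norm. An interval function is a function on $\mathcal{I}$ with values in some $\mathbb{R}^k$. It is quasi additive (on $A$) if for each $\varepsilon>0$ there exists $\eta(\varepsilon)>0$ such that for every $D_0=[I_0]\in\mathcal{D}$ with $\delta(D_0)<\eta(\varepsilon)$ there exists $\lambda(\varepsilon,D_0)>0$ such that for every $D=[I]\in\mathcal{D}$ with $\delta(D)<\lambda(\varepsilon,D_0)$, $$\sum_{I_0\in D_0}\Big\|\sum_{I\in D,\,I\subset I_0}\phi(I)-\phi(I_0)\Big\|<\varepsilon,\qquad \sum_{I\in D,\ I\not\subset I_0\text{ for any }I_0\in D_0}\|\phi(I)\|<\varepsilon .$$ $\mathrm{BC}\int_A\|\phi\|=\lim_{\delta(D)\to0}\sum_{I\in D}\|\phi(I)\|$. $F:X\times\mathbb{R}^M\to\mathbb{R}$ is a parametric integrand if it is continuous in $(\underline{x},\underline{t})$ and $F(\underline{x},K\underline{t})=KF(\underline{x},\underline{t})$ for all $K\ge0$. *)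

theory Defs
  imports "HOL-Analysis.Analysis"
begin

definition closed_subintervals :: "real \<Rightarrow> real \<Rightarrow> real set set" where
  "closed_subintervals a b = {{c..d} |c d. a \<le> c \<and> c < d \<and> d \<le> b}"

definition partitions :: "real \<Rightarrow> real \<Rightarrow> real set set set" where
  "partitions a b = {(\<lambda>i. {x (i - 1)..x i}) ` {1..n} |(n::nat) (x::nat \<Rightarrow> real).
     x 0 = a \<and> x n = b \<and> (\<forall>i\<in>{1..n}. x (i - 1) < x i)}"

definition mesh :: "real set set \<Rightarrow> real" where
  "mesh D = Max (diameter ` D)"

text \<open>Interval functions are total functions on sets of reals; only their values on
  \<^const>\<open>closed_subintervals\<close> matter, since partitions consist of such intervals.\<close>

definition quasi_additive ::
    "real \<Rightarrow> real \<Rightarrow> (real set \<Rightarrow> 'v::euclidean_space) \<Rightarrow> bool" where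
  "quasi_additive a b \<phi> \<longleftrightarrow>
     (\<forall>\<epsilon>>0. \<exists>\<eta>>0. \<forall>D0\<in>partitions a b. mesh D0 < \<eta> \<longrightarrow>
       (\<exists>l>0. \<forall>D\<in>partitions a b. mesh D < l \<longrightarrow>
          (\<Sum>I0\<in>D0. norm ((\<Sum>I | I \<in> D \<and> I \<subseteq> I0. \<phi> I) - \<phi> I0)) < \<epsilon> \<and>
          (\<Sum>I | I \<in> D \<and> (\<forall>I0\<in>D0. \<not> I \<subseteq> I0). norm (\<phi> I)) < \<epsilon>))"

definition mesh_to_0 :: "real \<Rightarrow> real \<Rightarrow> real set set filter" where
  "mesh_to_0 a b = inf (filtercomap mesh (at_right 0)) (principal (partitions a b))"

text \<open>The limit value is a real number, so this expresses both that the
  Burkill-Cesari integral exists and that it is finite.\<close>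

definition has_BC_integral :: "real \<Rightarrow> real \<Rightarrow> (real set \<Rightarrow> real) \<Rightarrow> real \<Rightarrow> bool" where
  "has_BC_integral a b f V \<longleftrightarrow> ((\<lambda>D. \<Sum>I\<in>D. f I) \<longlongrightarrow> V) (mesh_to_0 a b)"

definition parametric_integrand ::
    "'u::euclidean_space set \<Rightarrow> ('u \<times> 'v::euclidean_space \<Rightarrow> real) \<Rightarrow> bool" where
  "parametric_integrand X F \<longleftrightarrow>
     continuous_on (X \<times> UNIV) F \<and>
     (\<forall>x\<in>X. \<forall>t. \<forall>K\<ge>0. F (x, K *\<^sub>R t) = K * F (x, t))"

lemma mesh_partition:
  assumes "\<And>i. i \<in> {1..n} \<Longrightarrow> x (i - 1) < x i"
  shows "mesh ((\<lambda>i. {x (i - 1)..x i}) ` {1..n}) = Max ((\<lambda>i. x i - x (i - 1)) ` {1..n})"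
proof -
  have "diameter ` (\<lambda>i. {x (i - 1)..x i}) ` {1..n} = (\<lambda>i. x i - x (i - 1)) ` {1..n}"
    unfolding image_image using assms by (intro image_cong) (auto simp: not_less less_imp_le dest: less_asym)
  then show ?thesis by (simp add: mesh_def)
qed

lemma partition_points_ge:
  fixes x :: "nat \<Rightarrow> real"
  assumes "\<And>i. i \<in> {1..n} \<Longrightarrow> x (i - 1) < x i" "i \<le> j" "j \<le> n"
  shows "x i \<le> x j"
  using assms(2,3)
proof (induction j rule: dec_induct)
  case (step m)
  then show ?case using assms(1)[of "Suc m"] by simp
qed simp

lemma partitions_subset:
  assumes "D \<in> partitions a b"
  shows "D \<subseteq> closed_subintervals a b"
proof
  fix I assume "I \<in> D"
  with assms obtain n :: nat and x i where
    *: "x 0 = a" "x n = b" "\<And>i. i \<in> {1..n} \<Longrightarrow> x (i - 1) < x i"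
      "i \<in> {1..n}" "I = {x (i - 1)..x i}"
    unfolding partitions_def by auto
  have "a \<le> x (i - 1)" "x i \<le> b"
    using partition_points_ge[of n x 0 "i - 1", OF *(3)]
      partition_points_ge[of n x i n, OF *(3)] * by auto
  then show "I \<in> closed_subintervals a b"
    using *(3)[OF *(4)] *(5) unfolding closed_subintervals_def by blast
qed

lemma partition_mesh_pos:
  assumes "a < b" "D \<in> partitions a b"
  shows "mesh D > 0"
proof -
  obtain n :: nat and x where
    *: "x 0 = a" "x n = b" "\<And>i. i \<in> {1..n} \<Longrightarrow> x (i - 1) < x i"
      "D = (\<lambda>i. {x (i - 1)..x i}) ` {1..n}"
    using assms(2) unfolding partitions_def by auto
  have n: "1 \<in> {1..n}" using * assms(1) by (cases n) auto
  have "0 < x 1 - x (1 - 1)" using *(3)[OF n] by simp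
  also have "\<dots> \<le> Max ((\<lambda>i. x i - x (i - 1)) ` {1..n})"
    using n by (intro Max_ge) blast+
  also have "\<dots> = mesh D"
    unfolding *(4) by (rule mesh_partition[symmetric]) (rule *(3))
  finally show ?thesis .
qed

lemma eventually_mesh_to_0:
  assumes "a < b"
  shows "eventually P (mesh_to_0 a b) \<longleftrightarrow>
    (\<exists>r>0. \<forall>D\<in>partitions a b. mesh D < r \<longrightarrow> P D)"
proof
  assume "eventually P (mesh_to_0 a b)"
  then obtain Q where Q: "eventually Q (at_right 0)"
    "\<And>D. Q (mesh D) \<Longrightarrow> D \<in> partitions a b \<Longrightarrow> P D"
    unfolding mesh_to_0_def eventually_inf_principal eventually_filtercomap by blast
  then obtain r where "r > 0" "\<And>y. 0 < y \<Longrightarrow> y < r \<Longrightarrow> Q y"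
    unfolding eventually_at_right_field by blast
  then show "\<exists>r>0. \<forall>D\<in>partitions a b. mesh D < r \<longrightarrow> P D"
    using Q(2) partition_mesh_pos[OF assms] by blast
next
  assume "\<exists>r>0. \<forall>D\<in>partitions a b. mesh D < r \<longrightarrow> P D"
  then obtain r where r: "r > 0" "\<And>D. D \<in> partitions a b \<Longrightarrow> mesh D < r \<Longrightarrow> P D"
    by blast
  have "eventually (\<lambda>y. y < r) (at_right 0)"
    unfolding eventually_at_right_field using r(1) by blast
  then show "eventually P (mesh_to_0 a b)"
    unfolding mesh_to_0_def eventually_inf_principal eventually_filtercomap
    using r(2) by blast
qed

lemma mesh_to_0_neq_bot:
  assumes "a < b"
  shows "mesh_to_0 a b \<noteq> bot"
proof
  assume "mesh_to_0 a b = bot"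
  then have "eventually (\<lambda>_. False) (mesh_to_0 a b)" by simp
  then obtain r where r: "r > 0" "\<And>D. D \<in> partitions a b \<Longrightarrow> \<not> mesh D < r"
    unfolding eventually_mesh_to_0[OF assms] by auto
  obtain n :: nat where n2: "(b - a) / r < n"
    using reals_Archimedean2 by blast
  moreover have "0 < (b - a) / r" using assms r(1) by simp
  ultimately have n: "n > 0" "(b - a) / r < n" by (auto intro: gr0I)
  define x where "x i = a + real i * ((b - a) / n)" for i
  have step: "x i - x (i - 1) = (b - a) / n" if "i \<in> {1..n}" for i
    using that by (simp add: x_def of_nat_diff algebra_simps diff_divide_distrib)
  have pos: "(b - a) / n > 0" using assms n by simp
  have lt: "x (i - 1) < x i" if "i \<in> {1..n}" for i using step[OF that] pos by simp
  let ?D = "(\<lambda>i. {x (i - 1)..x i}) ` {1..n}"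
  have "?D \<in> partitions a b"
  proof -
    have "x 0 = a" "x n = b" using n by (simp_all add: x_def)
    with lt show ?thesis unfolding partitions_def by blast
  qed
  moreover have "mesh ?D < r"
  proof -
    have "mesh ?D = Max ((\<lambda>i. x i - x (i - 1)) ` {1..n})"
      by (rule mesh_partition) (rule lt)
    also have "(\<lambda>i. x i - x (i - 1)) ` {1..n} = (\<lambda>i. (b - a) / n) ` {1..n}"
      using step by (rule image_cong[OF refl])
    also have "\<dots> = {(b - a) / n}" using n by (subst image_constant_conv) simp
    also have "Max \<dots> < r" using n r(1) by (simp add: field_simps)
    finally show ?thesis .
  qed
  ultimately show False using r(2) by blast
qed

end

theory Submission
  imports Defs
begin

text \<open>
  Positive homogeneity makes the values of \<open>F\<close> on \<open>X \<times> sphere 0 1\<close>, a compact set, control \<open>F\<close>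
  everywhere.  Let \<open>I0\<close> be a cell of a coarse partition, let \<open>u\<close> be the direction of \<open>\<phi> I0\<close>, and let
  \<open>I\<close> run through the cells of a fine partition lying in \<open>I0\<close>.  If most of the mass \<open>norm (\<phi> I)\<close>
  sits on cells whose own direction is close to \<open>u\<close>, then \<open>F (\<zeta> I, \<phi> I)\<close> is essentially
  \<open>norm (\<phi> I) * F (\<zeta> I0, u)\<close> by uniform continuity, and the comparison of \<open>F\<close> on \<open>I0\<close> with the sum
  over the \<open>I\<close> reduces to the comparison of \<open>norm (\<phi> I0)\<close> with the sum of the \<open>norm (\<phi> I)\<close>.

  That the mass does concentrate on the direction \<open>u\<close> follows from the identity
  \<open>1 - v \<bullet> u = (norm (v - u))\<^sup>2 / 2\<close> for unit vectors: the defect \<open>norm t - t \<bullet> u\<close> bounds the mass of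
  the vectors pointing away from \<open>u\<close>.  Its sum over the cells in \<open>I0\<close> is the sum of the norms minus
  the component of the sum of the \<open>\<phi> I\<close> along \<open>u\<close>.  By quasi additivity that component is nearly
  \<open>norm (\<phi> I0)\<close>, so summing over \<open>I0\<close> leaves the difference of two sums of norms, and both are close
  to the Burkill-Cesari integral.  The lemma \<open>parametric_integrand_defect\<close> bounds the variation of
  \<open>F\<close> by the defect, \<open>cell_estimate\<close> sums this bound over one cell, and \<open>quasi_additivity_estimate\<close>
  sums over all cells.
\<close>

section \<open>Cells of a partition\<close>

lemma finite_partition: "D \<in> partitions a b \<Longrightarrow> finite D"
  unfolding partitions_def by auto

text \<open>Two different cells of a partition have at most an endpoint in common, whereas the members of
  \<^const>\<open>closed_subintervals\<close> have two distinct points.\<close>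

lemma partition_cell_unique:
  assumes "D \<in> partitions a b" "I0 \<in> D" "I1 \<in> D"
    and "I \<in> closed_subintervals a' b'" "I \<subseteq> I0" "I \<subseteq> I1"
  shows "I0 = I1"
proof -
  obtain n :: nat and x where
    x: "\<And>i. i \<in> {1..n} \<Longrightarrow> x (i - 1) < x i" "D = (\<lambda>i. {x (i - 1)..x i}) ` {1..n}"
    using assms(1) unfolding partitions_def by blast
  obtain c d where I: "c < d" "I = {c..d}"
    using assms(4) unfolding closed_subintervals_def by auto
  obtain i j where ij: "i \<in> {1..n}" "I0 = {x (i - 1)..x i}" "j \<in> {1..n}" "I1 = {x (j - 1)..x j}"
    using assms(2,3) x(2) by auto
  have cd: "x (i - 1) \<le> c" "d \<le> x i" "x (j - 1) \<le> c" "d \<le> x j"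
    using assms(5,6) I ij by auto
  have "\<not> i < j"
  proof
    assume "i < j"
    then have "x i \<le> x (j - 1)"
      using ij by (intro partition_points_ge[of n x] x(1)) auto
    with cd I show False by linarith
  qed
  moreover have "\<not> j < i"
  proof
    assume "j < i"
    then have "x j \<le> x (i - 1)"
      using ij by (intro partition_points_ge[of n x] x(1)) auto
    with cd I show False by linarith
  qed
  ultimately show ?thesis using ij by (metis linorder_neqE_nat)
qed

lemma sum_over_cells_le:
  fixes h :: "real set \<Rightarrow> real"
  assumes "D0 \<in> partitions a b" "D \<in> partitions a b" "\<And>I. h I \<ge> 0"
  shows "(\<Sum>I0\<in>D0. \<Sum>I | I \<in> D \<and> I \<subseteq> I0. h I) \<le> (\<Sum>I\<in>D. h I)"
proof -
  have "(\<Sum>I0\<in>D0. \<Sum>I | I \<in> D \<and> I \<subseteq> I0. h I) = sum h (\<Union>I0\<in>D0. {I. I \<in> D \<and> I \<subseteq> I0})"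
  proof (rule sum.UNION_disjoint[symmetric])
    show "finite D0" "\<forall>I0\<in>D0. finite {I. I \<in> D \<and> I \<subseteq> I0}"
      using assms(1,2) finite_partition by auto
    show "\<forall>I0\<in>D0. \<forall>I1\<in>D0. I0 \<noteq> I1 \<longrightarrow> {I. I \<in> D \<and> I \<subseteq> I0} \<inter> {I. I \<in> D \<and> I \<subseteq> I1} = {}"
      using partition_cell_unique[OF assms(1)] partitions_subset[OF assms(2)] by blast
  qed
  also have "\<dots> \<le> sum h D"
    using finite_partition[OF assms(2)] assms(3) by (intro sum_mono2) auto
  finally show ?thesis .
qed

section \<open>Compactness estimates for parametric integrands\<close>

lemma parametric_integrand_sgn:
  assumes "parametric_integrand X F" "x \<in> X"
  shows "F (x, t) = norm t * F (x, sgn t)"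
proof -
  have "F (x, norm t *\<^sub>R sgn t) = norm t * F (x, sgn t)"
    using assms unfolding parametric_integrand_def by simp
  then show ?thesis by (cases "t = 0") (simp_all add: sgn_div_norm)
qed

lemma parametric_integrand_bound:
  fixes F :: "'u::euclidean_space \<times> 'v::euclidean_space \<Rightarrow> real"
  assumes "compact X" "parametric_integrand X F"
  obtains C where "C > 0" "\<And>x t. x \<in> X \<Longrightarrow> \<bar>F (x, t)\<bar> \<le> C * norm t"
proof -
  have "compact (F ` (X \<times> sphere 0 1))"
    using assms unfolding parametric_integrand_def
    by (intro compact_continuous_image compact_Times compact_sphere)
      (auto intro: continuous_on_subset)
  then obtain C where C: "C > 0" "\<And>y. y \<in> F ` (X \<times> sphere 0 1) \<Longrightarrow> norm y \<le> C"
    using compact_imp_bounded bounded_pos by metis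
  have "\<bar>F (x, t)\<bar> \<le> C * norm t" if "x \<in> X" for x t
  proof (cases "t = 0")
    case True
    then show ?thesis using parametric_integrand_sgn[OF assms(2) that, of t] by simp
  next
    case False
    have "\<bar>F (x, sgn t)\<bar> \<le> C"
      using C(2)[of "F (x, sgn t)"] that False by (auto simp: norm_sgn)
    then show ?thesis
      by (subst parametric_integrand_sgn[OF assms(2) that])
        (simp add: abs_mult mult.commute[of C] mult_left_mono)
  qed
  with C(1) that show ?thesis by blast
qed

text \<open>If \<open>t\<close> points nearly in the direction \<open>u\<close>, the first summand suffices by uniform continuity on
  \<open>X \<times> sphere 0 1\<close>.  Otherwise only the crude bound \<open>2 * C * norm t\<close> is available, but then the defect
  \<open>norm t - t \<bullet> u\<close> is at least a fixed multiple of \<open>norm t\<close>.\<close>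

lemma parametric_integrand_defect:
  fixes F :: "'u::euclidean_space \<times> 'v::euclidean_space \<Rightarrow> real"
  assumes "compact X" "parametric_integrand X F" "e > 0"
  obtains \<delta> K where "\<delta> > 0" "K > 0"
    "\<And>x y t u. \<lbrakk>x \<in> X; y \<in> X; norm (x - y) < \<delta>; norm u = 1\<rbrakk> \<Longrightarrow>
       \<bar>F (x, t) - norm t * F (y, u)\<bar> \<le> e * norm t + K * (norm t - t \<bullet> u)"
proof -
  obtain C where C: "C > 0" "\<And>x t. x \<in> X \<Longrightarrow> \<bar>F (x, t)\<bar> \<le> C * norm t"
    using parametric_integrand_bound[OF assms(1,2)] by blast
  have "uniformly_continuous_on (X \<times> sphere 0 1) F"
    using assms(1,2) unfolding parametric_integrand_def
    by (intro compact_uniformly_continuous compact_Times compact_sphere)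
      (auto intro: continuous_on_subset)
  then obtain d where d: "d > 0"
    "\<And>p q. p \<in> X \<times> sphere 0 1 \<Longrightarrow> q \<in> X \<times> sphere 0 1 \<Longrightarrow> dist p q < d \<Longrightarrow> dist (F p) (F q) < e"
    using assms(3) unfolding uniformly_continuous_on_def by metis
  define K where "K = 16 * C / d\<^sup>2"
  have K: "K > 0" using C(1) d(1) by (simp add: K_def)
  have "\<bar>F (x, t) - norm t * F (y, u)\<bar> \<le> e * norm t + K * (norm t - t \<bullet> u)"
    if xy: "x \<in> X" "y \<in> X" "norm (x - y) < d / 2" and u: "norm u = 1" for x y t u
  proof (cases "t = 0")
    case True
    then show ?thesis using C(2)[OF xy(1), of t] by simp
  next
    case False
    define v where "v = sgn t"
    have v: "norm v = 1" "t = norm t *\<^sub>R v"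
      using False by (simp_all add: v_def norm_sgn sgn_div_norm)
    have tu: "t \<bullet> u = norm t * (v \<bullet> u)"
      by (subst v(2)) (simp add: v(1))
    have defect: "1 - v \<bullet> u = (norm (v - u))\<^sup>2 / 2"
      using v(1) u by (simp add: power2_norm_eq_inner algebra_simps norm_eq_1 inner_commute)
    have "\<bar>F (x, v) - F (y, u)\<bar> \<le> e + K * (1 - v \<bullet> u)"
    proof (cases "norm (v - u) < d / 2")
      case True
      have "dist (x, v) (y, u) \<le> norm (x - y) + norm (v - u)"
        unfolding dist_norm diff_Pair by (rule norm_Pair_le)
      then have "dist (x, v) (y, u) < d" using True xy(3) by simp
      then have "\<bar>F (x, v) - F (y, u)\<bar> < e"
        using d(2)[of "(x, v)" "(y, u)"] xy u v(1) by (simp add: dist_real_def)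
      moreover have "0 \<le> K * (1 - v \<bullet> u)" using K unfolding defect by simp
      ultimately show ?thesis by simp
    next
      case False
      then have "(d / 2)\<^sup>2 \<le> (norm (v - u))\<^sup>2"
        using d(1) by (intro power_mono) auto
      then have "d\<^sup>2 / 8 \<le> 1 - v \<bullet> u" unfolding defect by (simp add: power_divide)
      then have "K * (d\<^sup>2 / 8) \<le> K * (1 - v \<bullet> u)" using K by simp
      moreover have "K * (d\<^sup>2 / 8) = 2 * C" using d(1) by (simp add: K_def)
      moreover have "\<bar>F (x, v)\<bar> \<le> C" "\<bar>F (y, u)\<bar> \<le> C"
        using C(2)[OF xy(1), of v] C(2)[OF xy(2), of u] v(1) u by simp_all
      ultimately show ?thesis using assms(3) by linarith
    qed
    then have scaled: "norm t * \<bar>F (x, v) - F (y, u)\<bar> \<le> norm t * (e + K * (1 - v \<bullet> u))"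
      by (rule mult_left_mono) simp
    have diff: "F (x, t) - norm t * F (y, u) = norm t * (F (x, v) - F (y, u))"
      using parametric_integrand_sgn[OF assms(2) xy(1), of t] by (simp add: v_def algebra_simps)
    have "\<bar>F (x, t) - norm t * F (y, u)\<bar> = norm t * \<bar>F (x, v) - F (y, u)\<bar>"
      unfolding diff by (simp add: abs_mult)
    with scaled show ?thesis by (simp add: tu distrib_left mult_ac right_diff_distrib)
  qed
  then show ?thesis using that[of "d / 2" K] d(1) K by simp
qed

section \<open>Passage from a coarse partition to a fine one\<close>

text \<open>The excess of the sum of the norms over \<open>norm p\<close> enters without absolute value, so that its
  sum over all cells is bounded by a difference of two sums of norms.  It can be negative only to
  the extent of \<open>norm (sum \<phi> S - p)\<close>, which accounts for the factor 2.\<close>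

lemma cell_estimate:
  fixes \<phi> :: "'i \<Rightarrow> 'v::euclidean_space" and f :: "'i \<Rightarrow> real"
  assumes f: "\<And>I. I \<in> S \<Longrightarrow> \<bar>f I - norm (\<phi> I) * c\<bar> \<le> e * norm (\<phi> I) + K * (norm (\<phi> I) - \<phi> I \<bullet> u)"
    and u: "norm u = 1" "p = norm p *\<^sub>R u" and "\<bar>c\<bar> \<le> C" "K \<ge> 0"
  shows "\<bar>sum f S - norm p * c\<bar> \<le> e * (\<Sum>I\<in>S. norm (\<phi> I))
    + (K + C) * ((\<Sum>I\<in>S. norm (\<phi> I)) - norm p) + (K + 2 * C) * norm (sum \<phi> S - p)"
proof -
  define N where "N = (\<Sum>I\<in>S. norm (\<phi> I))"
  define r where "r = norm (sum \<phi> S - p)"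
  have C: "C \<ge> 0" using assms(4) by linarith
  have "\<bar>sum f S - N * c\<bar> = \<bar>\<Sum>I\<in>S. f I - norm (\<phi> I) * c\<bar>"
    by (simp add: N_def sum_subtractf sum_distrib_right)
  also have "\<dots> \<le> (\<Sum>I\<in>S. e * norm (\<phi> I) + K * (norm (\<phi> I) - \<phi> I \<bullet> u))"
    using f by (intro order_trans[OF sum_abs] sum_mono) auto
  also have "\<dots> = e * N + K * (N - sum \<phi> S \<bullet> u)"
    by (simp add: N_def sum.distrib sum_subtractf flip: sum_distrib_left inner_sum_left)
  finally have 1: "\<bar>sum f S - N * c\<bar> \<le> e * N + K * (N - sum \<phi> S \<bullet> u)" .
  have "p \<bullet> u = norm p"
    by (subst u(2)) (use u(1) in \<open>simp add: norm_eq_1\<close>)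
  moreover have "\<bar>(sum \<phi> S - p) \<bullet> u\<bar> \<le> r"
    using Cauchy_Schwarz_ineq2[of "sum \<phi> S - p" u] u(1) by (simp add: r_def)
  ultimately have "N - sum \<phi> S \<bullet> u \<le> N - norm p + r"
    by (simp add: inner_diff_left)
  then have 2: "K * (N - sum \<phi> S \<bullet> u) \<le> K * (N - norm p + r)"
    using assms(5) by (rule mult_left_mono)
  have "norm p \<le> norm (sum \<phi> S) + r"
    unfolding r_def by norm
  also have "\<dots> \<le> N + r" by (simp add: N_def norm_sum)
  finally have "\<bar>N - norm p\<bar> \<le> N - norm p + 2 * r"
    by (simp add: abs_if r_def)
  then have "\<bar>N - norm p\<bar> * \<bar>c\<bar> \<le> (N - norm p + 2 * r) * C"
    using assms(4) C by (intro mult_mono) (auto simp: r_def)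
  then have 3: "\<bar>N * c - norm p * c\<bar> \<le> (N - norm p + 2 * r) * C"
    by (simp add: left_diff_distrib flip: abs_mult)
  have "\<bar>sum f S - norm p * c\<bar> \<le> \<bar>sum f S - N * c\<bar> + \<bar>N * c - norm p * c\<bar>"
    by linarith
  also have "\<dots> \<le> e * N + K * (N - norm p + r) + (N - norm p + 2 * r) * C"
    using 1 2 3 by linarith
  finally show ?thesis
    unfolding N_def[symmetric] r_def[symmetric] by (simp add: algebra_simps)
qed

lemma quasi_additivity_estimate:
  fixes \<phi> :: "real set \<Rightarrow> 'v::euclidean_space" and \<zeta> :: "real set \<Rightarrow> 'u::euclidean_space"
    and F :: "'u \<times> 'v \<Rightarrow> real"
  assumes D0: "D0 \<in> partitions a b" and D: "D \<in> partitions a b"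
    and F: "parametric_integrand X F" and \<zeta>: "\<forall>I\<in>closed_subintervals a b. \<zeta> I \<in> X"
    and C: "\<And>x t. x \<in> X \<Longrightarrow> \<bar>F (x, t)\<bar> \<le> C * norm t" "C \<ge> 0"
    and K: "\<And>x y t u. \<lbrakk>x \<in> X; y \<in> X; norm (x - y) < \<delta>; norm u = 1\<rbrakk> \<Longrightarrow>
       \<bar>F (x, t) - norm t * F (y, u)\<bar> \<le> e * norm t + K * (norm t - t \<bullet> u)" "K \<ge> 0"
    and near: "\<forall>I0\<in>D0. \<forall>I\<in>D. I \<subseteq> I0 \<longrightarrow> norm (\<zeta> I - \<zeta> I0) < \<delta>"
    and "e \<ge> 0"
  shows "(\<Sum>I0\<in>D0. norm ((\<Sum>I | I \<in> D \<and> I \<subseteq> I0. F (\<zeta> I, \<phi> I)) - F (\<zeta> I0, \<phi> I0)))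
    \<le> e * (\<Sum>I\<in>D. norm (\<phi> I))
      + (K + C) * ((\<Sum>I\<in>D. norm (\<phi> I)) - (\<Sum>I0\<in>D0. norm (\<phi> I0)))
      + (K + 2 * C) * (\<Sum>I0\<in>D0. norm ((\<Sum>I | I \<in> D \<and> I \<subseteq> I0. \<phi> I) - \<phi> I0))"
proof -
  let ?N = "\<Sum>I\<in>D. norm (\<phi> I)" and ?M = "\<Sum>I0\<in>D0. norm (\<phi> I0)"
  let ?R = "\<Sum>I0\<in>D0. norm ((\<Sum>I | I \<in> D \<and> I \<subseteq> I0. \<phi> I) - \<phi> I0)"
  let ?n = "\<lambda>I0. \<Sum>I | I \<in> D \<and> I \<subseteq> I0. norm (\<phi> I)"
  have "norm ((\<Sum>I | I \<in> D \<and> I \<subseteq> I0. F (\<zeta> I, \<phi> I)) - F (\<zeta> I0, \<phi> I0))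
    \<le> e * ?n I0 + (K + C) * (?n I0 - norm (\<phi> I0))
      + (K + 2 * C) * norm ((\<Sum>I | I \<in> D \<and> I \<subseteq> I0. \<phi> I) - \<phi> I0)" if I0: "I0 \<in> D0" for I0
  proof -
    have x0: "\<zeta> I0 \<in> X" using \<zeta> I0 partitions_subset[OF D0] by blast
    \<comment> \<open>A cell with \<open>\<phi> I0 = 0\<close> has no direction, and any unit vector serves.\<close>
    obtain u :: 'v where u: "norm u = 1" "\<phi> I0 = norm (\<phi> I0) *\<^sub>R u"
    proof (cases "\<phi> I0 = 0")
      case True
      obtain w :: 'v where "norm w = 1" using vector_choose_size[of 1] by auto
      show ?thesis by (rule that[of w]) (simp_all add: True \<open>norm w = 1\<close>)
    next
      case False
      then show ?thesis by (intro that[of "sgn (\<phi> I0)"]) (simp_all add: norm_sgn sgn_div_norm)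
    qed
    have "F (\<zeta> I0, \<phi> I0) = F (\<zeta> I0, norm (\<phi> I0) *\<^sub>R u)"
      by (rule arg_cong[OF u(2)])
    also have "\<dots> = norm (\<phi> I0) * F (\<zeta> I0, u)"
      using F x0 unfolding parametric_integrand_def by simp
    finally have "F (\<zeta> I0, \<phi> I0) = norm (\<phi> I0) * F (\<zeta> I0, u)" .
    moreover have "\<bar>(\<Sum>I | I \<in> D \<and> I \<subseteq> I0. F (\<zeta> I, \<phi> I)) - norm (\<phi> I0) * F (\<zeta> I0, u)\<bar>
      \<le> e * ?n I0 + (K + C) * (?n I0 - norm (\<phi> I0))
        + (K + 2 * C) * norm ((\<Sum>I | I \<in> D \<and> I \<subseteq> I0. \<phi> I) - \<phi> I0)"
    proof (rule cell_estimate)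
      fix I assume "I \<in> {I. I \<in> D \<and> I \<subseteq> I0}"
      then have "\<zeta> I \<in> X" "norm (\<zeta> I - \<zeta> I0) < \<delta>"
        using \<zeta> partitions_subset[OF D] near I0 by auto
      then show "\<bar>F (\<zeta> I, \<phi> I) - norm (\<phi> I) * F (\<zeta> I0, u)\<bar>
          \<le> e * norm (\<phi> I) + K * (norm (\<phi> I) - \<phi> I \<bullet> u)"
        using x0 u(1) by (intro K(1))
    next
      show "\<bar>F (\<zeta> I0, u)\<bar> \<le> C" using C(1)[OF x0, of u] u(1) by simp
    qed (fact u K(2))+
    ultimately show ?thesis by simp
  qed
  then have "(\<Sum>I0\<in>D0. norm ((\<Sum>I | I \<in> D \<and> I \<subseteq> I0. F (\<zeta> I, \<phi> I)) - F (\<zeta> I0, \<phi> I0)))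
    \<le> (\<Sum>I0\<in>D0. e * ?n I0 + (K + C) * (?n I0 - norm (\<phi> I0))
      + (K + 2 * C) * norm ((\<Sum>I | I \<in> D \<and> I \<subseteq> I0. \<phi> I) - \<phi> I0))"
    by (rule sum_mono)
  also have "\<dots> = e * (\<Sum>I0\<in>D0. ?n I0) + (K + C) * ((\<Sum>I0\<in>D0. ?n I0) - ?M) + (K + 2 * C) * ?R"
    by (simp only: sum.distrib sum_subtractf sum_distrib_left[symmetric])
  also have "\<dots> \<le> e * ?N + (K + C) * (?N - ?M) + (K + 2 * C) * ?R"
  proof -
    have le: "(\<Sum>I0\<in>D0. ?n I0) \<le> ?N"
      by (rule sum_over_cells_le[OF D0 D]) simp
    have "e * (\<Sum>I0\<in>D0. ?n I0) \<le> e * ?N"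
      using le \<open>e \<ge> 0\<close> by (rule mult_left_mono)
    moreover have "(K + C) * ((\<Sum>I0\<in>D0. ?n I0) - ?M) \<le> (K + C) * (?N - ?M)"
      by (rule mult_left_mono) (use le C(2) K(2) in simp_all)
    ultimately show ?thesis by linarith
  qed
  finally show ?thesis .
qed

theorem mainTheorem3:
  fixes a b :: real
    and \<phi> :: "real set \<Rightarrow> real ^ 'm"
    and X :: "(real ^ 'n) set"
    and \<zeta> :: "real set \<Rightarrow> real ^ 'n"
    and F :: "(real ^ 'n) \<times> (real ^ 'm) \<Rightarrow> real"
  assumes "a < b"
    and "quasi_additive a b \<phi>"
    and "\<exists>V. has_BC_integral a b (\<lambda>I. norm (\<phi> I)) V"
    and "compact X"
    and "\<forall>I\<in>closed_subintervals a b. \<zeta> I \<in> X"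
    and "parametric_integrand X F"
    and "\<forall>\<epsilon>>0. \<exists>t>0. \<forall>D0\<in>partitions a b. mesh D0 < t \<longrightarrow>
           (\<exists>T>0. \<forall>D\<in>partitions a b. mesh D < T \<longrightarrow>
              (\<forall>I0\<in>D0. \<forall>I\<in>D. I \<subseteq> I0 \<longrightarrow> norm (\<zeta> I - \<zeta> I0) < \<epsilon>))"
  shows "quasi_additive a b (\<lambda>I. F (\<zeta> I, \<phi> I))"
proof -
  obtain V where "has_BC_integral a b (\<lambda>I. norm (\<phi> I)) V" using assms(3) by blast
  then have V: "\<exists>r>0. \<forall>D\<in>partitions a b. mesh D < r \<longrightarrow> \<bar>(\<Sum>I\<in>D. norm (\<phi> I)) - V\<bar> < \<epsilon>"
    if "\<epsilon> > 0" for \<epsilon>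
    using that unfolding has_BC_integral_def tendsto_iff eventually_mesh_to_0[OF assms(1)]
    by (simp add: dist_real_def)
  obtain C where C: "C > 0" "\<And>x t. x \<in> X \<Longrightarrow> \<bar>F (x, t)\<bar> \<le> C * norm t"
    using parametric_integrand_bound[OF assms(4,6)] by blast
  show ?thesis
    unfolding quasi_additive_def
  proof (intro allI impI)
    fix \<epsilon> :: real assume \<epsilon>: "\<epsilon> > 0"
    \<comment> \<open>The bound on the first sum will be \<open>e * (\<bar>V\<bar> + 1) + (3 * K + 4 * C) * \<epsilon>'\<close>.  As \<open>K\<close> depends on
      \<open>e\<close>, the tolerance \<open>\<epsilon>'\<close> for \<open>\<phi>\<close> is chosen after \<open>e\<close>.\<close>
    define e where "e = \<epsilon> / (2 * (\<bar>V\<bar> + 1))"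
    have "\<bar>V\<bar> + 1 > 0" by linarith
    then have e: "e > 0" "e * (\<bar>V\<bar> + 1) = \<epsilon> / 2"
      using \<epsilon> by (simp_all add: e_def field_simps)
    obtain \<delta> K where \<delta>: "\<delta> > 0" and K: "K > 0"
      "\<And>x y t u. \<lbrakk>x \<in> X; y \<in> X; norm (x - y) < \<delta>; norm u = 1\<rbrakk> \<Longrightarrow>
         \<bar>F (x, t) - norm t * F (y, u)\<bar> \<le> e * norm t + K * (norm t - t \<bullet> u)"
      using parametric_integrand_defect[OF assms(4,6) e(1)] by blast
    define \<epsilon>' where "\<epsilon>' = min 1 (\<epsilon> / (2 * (3 * K + 4 * C)))"
    have KC: "3 * K + 4 * C > 0" using K(1) C(1) by simp
    have \<epsilon>': "\<epsilon>' > 0" "\<epsilon>' \<le> 1" using \<epsilon> KC by (simp_all add: \<epsilon>'_def)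
    have "\<epsilon>' \<le> \<epsilon> / (2 * (3 * K + 4 * C))" by (simp add: \<epsilon>'_def)
    then have \<epsilon>'_le: "(3 * K + 4 * C) * \<epsilon>' \<le> \<epsilon> / 2" using KC by (simp add: field_simps)
    obtain r where r: "r > 0"
      "\<And>D. D \<in> partitions a b \<Longrightarrow> mesh D < r \<Longrightarrow> \<bar>(\<Sum>I\<in>D. norm (\<phi> I)) - V\<bar> < \<epsilon>'"
      using V[OF \<epsilon>'(1)] by blast
    obtain \<eta> where \<eta>: "\<eta> > 0"
      "\<forall>D0\<in>partitions a b. mesh D0 < \<eta> \<longrightarrow> (\<exists>l>0. \<forall>D\<in>partitions a b. mesh D < l \<longrightarrow>
          (\<Sum>I0\<in>D0. norm ((\<Sum>I | I \<in> D \<and> I \<subseteq> I0. \<phi> I) - \<phi> I0)) < \<epsilon>' \<and>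
          (\<Sum>I | I \<in> D \<and> (\<forall>I0\<in>D0. \<not> I \<subseteq> I0). norm (\<phi> I)) < \<epsilon>')"
      using assms(2)[unfolded quasi_additive_def, THEN spec, THEN mp, OF \<epsilon>'(1)]
      by (elim exE conjE) (rule that)
    obtain t where t: "t > 0"
      "\<forall>D0\<in>partitions a b. mesh D0 < t \<longrightarrow> (\<exists>T>0. \<forall>D\<in>partitions a b. mesh D < T \<longrightarrow>
          (\<forall>I0\<in>D0. \<forall>I\<in>D. I \<subseteq> I0 \<longrightarrow> norm (\<zeta> I - \<zeta> I0) < \<delta>))"
      using assms(7)[THEN spec, THEN mp, OF \<delta>]
      by (elim exE conjE) (rule that)
    show "\<exists>\<eta>>0. \<forall>D0\<in>partitions a b. mesh D0 < \<eta> \<longrightarrow>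
       (\<exists>l>0. \<forall>D\<in>partitions a b. mesh D < l \<longrightarrow>
          (\<Sum>I0\<in>D0. norm ((\<Sum>I | I \<in> D \<and> I \<subseteq> I0. F (\<zeta> I, \<phi> I)) - F (\<zeta> I0, \<phi> I0))) < \<epsilon> \<and>
          (\<Sum>I | I \<in> D \<and> (\<forall>I0\<in>D0. \<not> I \<subseteq> I0). norm (F (\<zeta> I, \<phi> I))) < \<epsilon>)"
    proof (rule exI[of _ "min r (min \<eta> t)"], intro conjI ballI impI)
      show "min r (min \<eta> t) > 0" using r(1) \<eta>(1) t(1) by simp
      fix D0 assume D0: "D0 \<in> partitions a b" and "mesh D0 < min r (min \<eta> t)"
      then have mesh0: "mesh D0 < r" "mesh D0 < \<eta>" "mesh D0 < t" by auto
      obtain l where l: "l > 0" "\<forall>D\<in>partitions a b. mesh D < l \<longrightarrow>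
          (\<Sum>I0\<in>D0. norm ((\<Sum>I | I \<in> D \<and> I \<subseteq> I0. \<phi> I) - \<phi> I0)) < \<epsilon>' \<and>
          (\<Sum>I | I \<in> D \<and> (\<forall>I0\<in>D0. \<not> I \<subseteq> I0). norm (\<phi> I)) < \<epsilon>'"
        using \<eta>(2)[THEN bspec, THEN mp, OF D0 mesh0(2)] by (elim exE conjE) (rule that)
      obtain T where T: "T > 0" "\<forall>D\<in>partitions a b. mesh D < T \<longrightarrow>
          (\<forall>I0\<in>D0. \<forall>I\<in>D. I \<subseteq> I0 \<longrightarrow> norm (\<zeta> I - \<zeta> I0) < \<delta>)"
        using t(2)[THEN bspec, THEN mp, OF D0 mesh0(3)] by (elim exE conjE) (rule that)
      show "\<exists>l>0. \<forall>D\<in>partitions a b. mesh D < l \<longrightarrow>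
          (\<Sum>I0\<in>D0. norm ((\<Sum>I | I \<in> D \<and> I \<subseteq> I0. F (\<zeta> I, \<phi> I)) - F (\<zeta> I0, \<phi> I0))) < \<epsilon> \<and>
          (\<Sum>I | I \<in> D \<and> (\<forall>I0\<in>D0. \<not> I \<subseteq> I0). norm (F (\<zeta> I, \<phi> I))) < \<epsilon>"
      proof (rule exI[of _ "min r (min l T)"], intro conjI ballI impI)
        show "min r (min l T) > 0" using r(1) l(1) T(1) by simp
        fix D assume D: "D \<in> partitions a b" and "mesh D < min r (min l T)"
        then have mesh: "mesh D < r" "mesh D < l" "mesh D < T" by auto
        note \<phi>_sums = l(2)[THEN bspec, THEN mp, OF D mesh(2)]
        let ?N = "\<lambda>D. \<Sum>I\<in>D. norm (\<phi> I)"
        let ?R = "\<Sum>I0\<in>D0. norm ((\<Sum>I | I \<in> D \<and> I \<subseteq> I0. \<phi> I) - \<phi> I0)"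
        have N: "\<bar>?N D - V\<bar> < \<epsilon>'" "\<bar>?N D0 - V\<bar> < \<epsilon>'" and R: "?R < \<epsilon>'"
          using r(2)[OF D mesh(1)] r(2)[OF D0 mesh0(1)] \<phi>_sums by simp_all
        have "(\<Sum>I0\<in>D0. norm ((\<Sum>I | I \<in> D \<and> I \<subseteq> I0. F (\<zeta> I, \<phi> I)) - F (\<zeta> I0, \<phi> I0)))
          \<le> e * ?N D + (K + C) * (?N D - ?N D0) + (K + 2 * C) * ?R"
          using C K(1) e(1)
          by (intro quasi_additivity_estimate[OF D0 D assms(6,5) C(2) _ K(2) _ T(2)[THEN bspec, THEN mp, OF D mesh(3)]])
            auto
        also have "\<dots> < e * (\<bar>V\<bar> + 1) + (K + C) * (2 * \<epsilon>') + (K + 2 * C) * \<epsilon>'"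
        proof (intro add_less_le_mono mult_strict_left_mono mult_left_mono)
          show "?N D < \<bar>V\<bar> + 1" using N(1) \<epsilon>'(2) by linarith
          show "?N D - ?N D0 \<le> 2 * \<epsilon>'" using N by linarith
        qed (use R K(1) C(1) e(1) in auto)
        also have "\<dots> \<le> \<epsilon>" using e(2) \<epsilon>'_le by (simp add: algebra_simps)
        finally show "(\<Sum>I0\<in>D0. norm ((\<Sum>I | I \<in> D \<and> I \<subseteq> I0. F (\<zeta> I, \<phi> I)) - F (\<zeta> I0, \<phi> I0))) < \<epsilon>" .
        have "(\<Sum>I | I \<in> D \<and> (\<forall>I0\<in>D0. \<not> I \<subseteq> I0). norm (F (\<zeta> I, \<phi> I)))
          \<le> (\<Sum>I | I \<in> D \<and> (\<forall>I0\<in>D0. \<not> I \<subseteq> I0). C * norm (\<phi> I))"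
          using assms(5) partitions_subset[OF D] by (intro sum_mono) (auto intro!: C(2))
        also have "\<dots> = C * (\<Sum>I | I \<in> D \<and> (\<forall>I0\<in>D0. \<not> I \<subseteq> I0). norm (\<phi> I))"
          by (simp add: sum_distrib_left)
        also have "\<dots> < C * \<epsilon>'"
          using \<phi>_sums C(1) by simp
        also have "\<dots> \<le> (3 * K + 4 * C) * \<epsilon>'"
          using K(1) C(1) \<epsilon>'(1) by (intro mult_right_mono) auto
        also have "\<dots> \<le> \<epsilon>" using \<epsilon>'_le \<epsilon> by linarith
        finally show "(\<Sum>I | I \<in> D \<and> (\<forall>I0\<in>D0. \<not> I \<subseteq> I0). norm (F (\<zeta> I, \<phi> I))) < \<epsilon>" .
      qed
    qed
  qed
qed

end
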